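(* Let $\hat k_0$ be the change point estimator defined in the context. The estimator $\hat\tau_0=\frac{\hat k_0}{n}$ satisfies $$|\hat\tau_0-\tau_0|=n^{-1/2}(\theta_2-\theta_1)^{-1}O_p(\sqrt{\log n})$$ (as $n\to\infty$, $\Delta_n\to0$ with $n\Delta_n=T$).
   Context: $[x]$ denotes the integer part of $x$. Model: $X=\{X_t,0\le t\le T\}$ is a one-dimensional diffusion with state space $I=(l,r)$, $-\infty\le l\le r\le+\infty$, solving $dX_t=b(X_t)\,dt+\sqrt{\theta}\,\sigma(X_t)\,dW_t$, $X_0=x_0$, with $W$ a standard Brownian motion. The volatility parameter switches at an unknown time $t^*\in(0,T)$: $\theta=\theta_1 1_{\{t\le t^*\}}+\theta_2 1_{\{t>t^*\}}$, with $\theta_1\ne\theta_2$ belonging to a compact set $\Theta$ of $\mathbb R^+$. The functions $b:I\to\mathbb R$ and $\sigma:I\to(0,\infty)$ are known with continuous derivatives. With $s(x)=\exp\{-\int_{x_0}^x 2b(u)/\sigma^2(u)\,du\}$ (the scale function), it is assumed that $\lim_{x_1\to l}\int_{x_1}^x s(u)\,du=-\infty$ and $\lim_{x_2\to r}\int_x^{x_2}s(u)\,du=+\infty$, where $l<x_1<x<x_2<r$ (a condition imposed so that the exit time from $I$ is infinite). Observation scheme: $X$ is observed at the $n+1$ times $t_i=i\Delta_n$, $i=0,\dots,n$, with $n\Delta_n=T$, and the asymptotics are $n\to\infty$, $\Delta_n\to0$ with $n\Delta_n=T$. Write $X_i=X_{t_i}$, $W_i=W_{t_i}$. The change is taken to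 occur exactly at $t^*=t_{k_0}=k_0\Delta_n$, where $k_0=[n\tau_0]$, $\tau_0\in(0,1)$. One works with the Euler approximation $X_i=X_{i-1}+b(X_{i-1})\Delta_n+\sqrt{\theta}\,\sigma(X_{i-1})(W_i-W_{i-1})$ and the quantities $$Z_i=\frac{X_i-X_{i-1}-b(X_{i-1})\Delta_n}{\sqrt{\Delta_n}\,\sigma(X_{i-1})}=\sqrt\theta\,\frac{W_i-W_{i-1}}{\sqrt{\Delta_n}},\qquad i=1,\dots,n,$$ which are independent centered normal variables, with variance $\theta_1$ for $i\le k_0$ and $\theta_2$ for $i>k_0$. Estimator: for $k=1,\dots,n-1$ let $S_k=\sum_{i=1}^kZ_i^2$, $S_n=\sum_{i=1}^nZ_i^2$, $S_{n-k}=\sum_{i=k+1}^nZ_i^2$ (the sum over the last $n-k$ indices), $\bar\theta_1=S_k/k$, $\bar\theta_2=S_{n-k}/(n-k)$, and $$D_k=\frac kn-\frac{S_k}{S_n},\qquad V_k=\left(\frac{k(n-k)}{n^2}\right)^{1/2}(\bar\theta_2-\bar\theta_1)=\frac{S_nD_k}{\sqrt{k(n-k)}}.$$ The change point estimator is $$\hat k_0=\arg\max_k|D_k|=\arg\max_k\,(k(n-k))^{1/2}|V_k|.$$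
   Formalization: The condition at l is read as the integral of s from x1 to x tending to +infinity (the printed -infinity is impossible since s>0), and b and sigma are extended arbitrarily beyond I, with sigma positive, because the Euler scheme may leave I. *)

theory Defs
  imports "HOL-Probability.Probability"
begin

definition standard_brownian_motion :: "'a measure \<Rightarrow> (real \<Rightarrow> 'a \<Rightarrow> real) \<Rightarrow> bool" where
  "standard_brownian_motion M W \<longleftrightarrow>
     prob_space M \<and>
     (\<forall>t\<ge>0. W t \<in> borel_measurable M) \<and>
     (AE \<omega> in M. W 0 \<omega> = 0) \<and>
     (AE \<omega> in M. continuous_on {0..} (\<lambda>t. W t \<omega>)) \<and>
     (\<forall>s t. 0 \<le> s \<and> s < t \<longrightarrow>
        distributed M lborel (\<lambda>\<omega>. W t \<omega> - W s \<omega>) (normal_density 0 (sqrt (t - s)))) \<and>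
     (\<forall>(m::nat) (t::nat \<Rightarrow> real). 0 \<le> t 0 \<and> (\<forall>i<m. t i < t (Suc i)) \<longrightarrow>
        prob_space.indep_vars M (\<lambda>_. borel) (\<lambda>i \<omega>. W (t (Suc i)) \<omega> - W (t i) \<omega>) {..<m})"

(* The interval integral is oriented, so this is also the intended function for x < x0. *)
definition scale_fun :: "(real \<Rightarrow> real) \<Rightarrow> (real \<Rightarrow> real) \<Rightarrow> real \<Rightarrow> real \<Rightarrow> real" where
  "scale_fun b \<sigma> x0 x = exp (- (LBINT u=ereal x0..ereal x. 2 * b u / (\<sigma> u)\<^sup>2))"

definition change_index :: "real \<Rightarrow> nat \<Rightarrow> nat" where
  "change_index \<tau> n = nat \<lfloor>real n * \<tau>\<rfloor>"

(* Value of the switching parameter on the i-th step, i.e. on (t_(i-1), t_i]. *)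
definition step_level :: "real \<Rightarrow> real \<Rightarrow> nat \<Rightarrow> nat \<Rightarrow> real" where
  "step_level \<theta>1 \<theta>2 k0 i = (if i \<le> k0 then \<theta>1 else \<theta>2)"

(* Euler scheme with step length d, driven by a path w.  The scheme may step outside the state
   space, so b and \<sigma> are total functions here. *)
primrec euler ::
  "(real \<Rightarrow> real) \<Rightarrow> (real \<Rightarrow> real) \<Rightarrow> (nat \<Rightarrow> real) \<Rightarrow> real \<Rightarrow> real \<Rightarrow> (real \<Rightarrow> real) \<Rightarrow> nat \<Rightarrow> real" where
  "euler b \<sigma> \<theta> d x0 w 0 = x0"
| "euler b \<sigma> \<theta> d x0 w (Suc i) =
     euler b \<sigma> \<theta> d x0 w i + b (euler b \<sigma> \<theta> d x0 w i) * d
     + sqrt (\<theta> (Suc i)) * \<sigma> (euler b \<sigma> \<theta> d x0 w i) * (w (real (Suc i) * d) - w (real i * d))"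

(* Meaningful for i >= 1. *)
definition standardized_increment ::
  "(real \<Rightarrow> real) \<Rightarrow> (real \<Rightarrow> real) \<Rightarrow> real \<Rightarrow> (nat \<Rightarrow> real) \<Rightarrow> nat \<Rightarrow> real" where
  "standardized_increment b \<sigma> d x i =
     (x i - x (i - 1) - b (x (i - 1)) * d) / (sqrt d * \<sigma> (x (i - 1)))"

definition sq_sum :: "(nat \<Rightarrow> real) \<Rightarrow> nat \<Rightarrow> real" where
  "sq_sum z k = (\<Sum>i=1..k. (z i)\<^sup>2)"

definition cusum_stat :: "nat \<Rightarrow> (nat \<Rightarrow> real) \<Rightarrow> nat \<Rightarrow> real" where
  "cusum_stat n z k = real k / real n - sq_sum z k / sq_sum z n"

(* Ties are broken by the (unspecified) choice of the library's arg max.  This choice depends only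
   on the set of maximizers, hence the estimator is a random variable. *)
definition change_estimator :: "nat \<Rightarrow> (nat \<Rightarrow> real) \<Rightarrow> nat" where
  "change_estimator n z = (ARG_MAX (\<lambda>k. \<bar>cusum_stat n z k\<bar>) k. k \<in> {1..n - 1})"

definition change_fraction_estimator ::
  "(real \<Rightarrow> real) \<Rightarrow> (real \<Rightarrow> real) \<Rightarrow> real \<Rightarrow> nat \<Rightarrow> (nat \<Rightarrow> real) \<Rightarrow> real" where
  "change_fraction_estimator b \<sigma> d n x =
     real (change_estimator n (standardized_increment b \<sigma> d x)) / real n"

(* R n = O_p(a n).  Measurability is part of the definition because measure is 0 on
   non-measurable sets. *)
definition bigO_p :: "'a measure \<Rightarrow> (nat \<Rightarrow> 'a \<Rightarrow> real) \<Rightarrow> (nat \<Rightarrow> real) \<Rightarrow> bool" where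
  "bigO_p M R a \<longleftrightarrow>
     (\<forall>n. R n \<in> borel_measurable M) \<and>
     (\<forall>\<epsilon>>0. \<exists>C>0. \<forall>\<^sub>F n in sequentially.
        measure M {\<omega> \<in> space M. \<bar>R n \<omega>\<bar> > C * \<bar>a n\<bar>} \<le> \<epsilon>)"

end

(* Multiplied by n S_n, the statistic D_k is a deterministic tent k \<mapsto> g_k (\<theta>2 - \<theta>1) with peak at k0
   and slopes of order n, plus noise at most 2 n max_k |S_k - E S_k|.  Comparing its values at k0 and
   at the maximizer shows that |k0hat - k0| is O(max_k |S_k - E S_k|), provided S_n > 0, which holds as soon as
   this maximum is below E S_n.  By Kolmogorov's maximal inequality, the maximum is O_p(sqrt n), which
   even gives the rate without the logarithm. *)

theory Submission
  imports Defs
begin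

section \<open>Kolmogorov's maximal inequality through stopped partial sums\<close>

text \<open>Absence of a passage up to time \<open>k\<close> is decided by \<open>x 0\<close>, ...,
  \<open>x (k - 1)\<close> alone, so for independent variables it is independent of the next
  one.\<close>

definition below_level :: "real \<Rightarrow> (nat \<Rightarrow> real) \<Rightarrow> nat \<Rightarrow> bool" where
  "below_level a x k \<longleftrightarrow> (\<forall>j\<le>k. \<bar>\<Sum>i<j. x i\<bar> < a)"

text \<open>The partial sums stopped at the first passage, written as a martingale transform with
  the predictable coefficient \<open>below_level a x k\<close>; this avoids an explicit stopping
  time.\<close>

primrec stopped_sum :: "real \<Rightarrow> (nat \<Rightarrow> real) \<Rightarrow> nat \<Rightarrow> real" where
  "stopped_sum a x 0 = 0"
| "stopped_sum a x (Suc k) = stopped_sum a x k + of_bool (below_level a x k) * x k"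

text \<open>The conclusion is at \<open>Suc k\<close> because the decision to add \<open>x k\<close>
  is taken before \<open>x k\<close> is seen: the step that crosses the level still counts in
  full.\<close>

lemma stopped_sum_below_level:
  assumes "below_level a x k"
  shows "stopped_sum a x (Suc k) = (\<Sum>i<Suc k. x i)"
  using assms
proof (induction k)
  case 0
  then show ?case by simp
next
  case (Suc k)
  then have "below_level a x k" by (simp add: below_level_def)
  with Suc show ?case by simp
qed

text \<open>At the first passage the stopped sum equals the partial sum that crossed the level, and
  afterwards it is frozen. Time 0 cannot be the passage since \<open>0 < a\<close>.\<close>

lemma stopped_sum_ge:
  assumes "0 < a" and "\<not> below_level a x n"
  shows "a \<le> \<bar>stopped_sum a x n\<bar>"
  using assms(2)
proof (induction n)
  case 0
  then show ?case using \<open>0 < a\<close> by (simp add: below_level_def)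
next
  case (Suc n)
  show ?case
  proof (cases "below_level a x n")
    case True
    then have "a \<le> \<bar>\<Sum>i<Suc n. x i\<bar>"
      using Suc.prems by (auto simp: below_level_def le_Suc_eq not_less)
    then show ?thesis using stopped_sum_below_level[OF True] by simp
  next
    case False
    then show ?thesis using Suc.IH by simp
  qed
qed

lemma below_level_cong:
  "(\<And>i. i < k \<Longrightarrow> x i = y i) \<Longrightarrow> below_level a x k = below_level a y k"
  unfolding below_level_def by (intro all_cong) (auto intro!: sum.cong arg_cong[of _ _ "\<lambda>s. \<bar>s\<bar> < a"])

text \<open>Measurability is asked for indices below \<open>k\<close> only, so that the lemma covers
  the coordinates of the finite product over \<open>{..<k}\<close> as well as the random variables
  themselves.\<close>

lemma below_level_sets:
  assumes "\<And>i. i < k \<Longrightarrow> (\<lambda>\<omega>. X i \<omega>) \<in> borel_measurable M"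
  shows "Measurable.pred M (\<lambda>\<omega>. below_level a (\<lambda>i. X i \<omega>) k)"
proof -
  have *: "(\<lambda>\<omega>. \<Sum>i<j. X i \<omega>) \<in> borel_measurable M" if "j \<le> k" for j
    using assms that by (intro borel_measurable_sum) auto
  have "Measurable.pred M (\<lambda>\<omega>. \<bar>\<Sum>i<j. X i \<omega>\<bar> < a)" if "j \<in> {..k}" for j
    by (rule borel_measurable_pred_less) (use * that in simp_all)
  then have "Measurable.pred M (\<lambda>\<omega>. \<forall>j\<in>{..k}. \<bar>\<Sum>i<j. X i \<omega>\<bar> < a)"
    by (rule pred_intros_finite(3)[rotated]) simp_all
  then show ?thesis unfolding below_level_def Ball_def atMost_iff .
qed

context prob_space
begin

(* The partial sums stopped at the first passage over a have orthogonal increments: before the passage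
   they depend on earlier variables only, and they are bounded by a.  On the event in question
   the stopped sum has absolute value at least a at time n, so Chebyshev's inequality applies. *)
theorem Kolmogorov_maximal_inequality:
  fixes X :: "nat \<Rightarrow> 'a \<Rightarrow> real"
  assumes indep: "indep_vars (\<lambda>_. borel) X {..<n}"
    and sq: "\<And>i. i < n \<Longrightarrow> integrable M (\<lambda>\<omega>. (X i \<omega>)\<^sup>2)"
    and mean: "\<And>i. i < n \<Longrightarrow> expectation (X i) = 0"
    and a: "0 < a"
  shows "prob {\<omega> \<in> space M. \<exists>k\<le>n. a \<le> \<bar>\<Sum>i<k. X i \<omega>\<bar>} \<le> (\<Sum>i<n. expectation (\<lambda>\<omega>. (X i \<omega>)\<^sup>2)) / a\<^sup>2"
proof -
  define T where "T k \<omega> = stopped_sum a (\<lambda>i. X i \<omega>) k" for k \<omega>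
  define B where "B k \<omega> = (of_bool (below_level a (\<lambda>i. X i \<omega>) k) :: real)" for k \<omega>
  \<comment> \<open>\<open>U k\<close> expresses \<open>T k * B k\<close> through the first
    \<open>k\<close> values of the path: before the passage the stopped sum is the plain partial
    sum. This form shows both the bound \<open>a\<close> and the independence of
    \<open>X k\<close>.\<close>
  define U where "U k x = of_bool (below_level a x k) * (\<Sum>i<k. x i)" for k and x :: "nat \<Rightarrow> real"
  have meas: "X i \<in> borel_measurable M" if "i < n" for i
    using conjunct1[OF indep[unfolded indep_vars_def]] that by simp
  have int: "integrable M (X i)" if "i < n" for i
    using square_integrable_imp_integrable[OF meas[OF that] sq[OF that]] .
  have B_meas: "B k \<in> borel_measurable M" if "k \<le> n" for k
  proof -
    have "Measurable.pred M (\<lambda>\<omega>. below_level a (\<lambda>i. X i \<omega>) k)"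
      using that by (intro below_level_sets meas) auto
    then show ?thesis unfolding B_def by measurable
  qed
  have TB: "T k \<omega> * B k \<omega> = U k (\<lambda>i. X i \<omega>)" for k \<omega>
  proof (cases "below_level a (\<lambda>i. X i \<omega>) k")
    case True
    then show ?thesis
    proof (cases k)
      case 0
      then show ?thesis by (simp add: T_def U_def)
    next
      case (Suc j)
      with True have "below_level a (\<lambda>i. X i \<omega>) j" by (simp add: below_level_def)
      from stopped_sum_below_level[OF this] show ?thesis
        using True Suc by (simp add: T_def B_def U_def del: stopped_sum.simps)
    qed
  qed (simp add: B_def U_def)
  have U_bound: "\<bar>U k x\<bar> \<le> a" for k x
    using a by (auto simp: U_def below_level_def of_bool_def less_imp_le)
  have T_Suc: "(T (Suc k) \<omega>)\<^sup>2 = (T k \<omega>)\<^sup>2 + 2 * (U k (\<lambda>i. X i \<omega>) * X k \<omega>) + B k \<omega> * (X k \<omega>)\<^sup>2" for k \<omega>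
  proof -
    have "(T (Suc k) \<omega>)\<^sup>2 = (T k \<omega> + B k \<omega> * X k \<omega>)\<^sup>2" by (simp add: T_def B_def)
    also have "\<dots> = (T k \<omega>)\<^sup>2 + 2 * ((T k \<omega> * B k \<omega>) * X k \<omega>) + (B k \<omega> * B k \<omega>) * (X k \<omega>)\<^sup>2"
      by (simp add: power2_eq_square algebra_simps)
    also have "B k \<omega> * B k \<omega> = B k \<omega>" by (simp add: B_def)
    finally show ?thesis by (simp add: TB)
  qed
  have cross: "integrable M (\<lambda>\<omega>. U k (\<lambda>i. X i \<omega>) * X k \<omega>) \<and> expectation (\<lambda>\<omega>. U k (\<lambda>i. X i \<omega>) * X k \<omega>) = 0"
    if k: "k < n" for k
  proof -
    have U_meas: "U k \<in> borel_measurable (Pi\<^sub>M {..<k} (\<lambda>_. borel :: real measure))"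
    proof -
      have *: "(\<lambda>x. x i) \<in> borel_measurable (Pi\<^sub>M {..<k} (\<lambda>_. borel :: real measure))" if "i < k" for i :: nat
        using that by (intro measurable_component_singleton) auto
      have [measurable]: "Measurable.pred (Pi\<^sub>M {..<k} (\<lambda>_. borel :: real measure)) (\<lambda>x. below_level a (\<lambda>i. x i) k)"
        by (intro below_level_sets *)
      have [measurable]: "(\<lambda>x. \<Sum>i<k. x i) \<in> borel_measurable (Pi\<^sub>M {..<k} (\<lambda>_. borel :: real measure))"
        using borel_measurable_sum[of "{..<k}" "\<lambda>i x. x i :: real" "Pi\<^sub>M {..<k} (\<lambda>_. borel :: real measure)"] * by simp
      show ?thesis unfolding U_def by measurable
    qed
    have "indep_var (Pi\<^sub>M {..<k} (\<lambda>_. borel)) (\<lambda>\<omega>. restrict (\<lambda>i. X i \<omega>) {..<k})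
                    (Pi\<^sub>M {k} (\<lambda>_. borel)) (\<lambda>\<omega>. restrict (\<lambda>i. X i \<omega>) {k})"
      using k by (intro indep_var_restrict[OF indep]) auto
    then have "indep_var borel (U k \<circ> (\<lambda>\<omega>. restrict (\<lambda>i. X i \<omega>) {..<k}))
                         borel ((\<lambda>x. x k) \<circ> (\<lambda>\<omega>. restrict (\<lambda>i. X i \<omega>) {k}))"
      by (rule indep_var_compose) (auto intro: U_meas)
    \<comment> \<open>\<open>U k\<close> looks at coordinates below \<open>k\<close> only, so the
      value \<open>undefined\<close> that \<open>restrict\<close> puts elsewhere does not change
      it.\<close>
    moreover have "U k \<circ> (\<lambda>\<omega>. restrict (\<lambda>i. X i \<omega>) {..<k}) = (\<lambda>\<omega>. U k (\<lambda>i. X i \<omega>))"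
      unfolding U_def comp_def
      by (intro ext arg_cong2[where f="(*)"] arg_cong[where f=of_bool] below_level_cong sum.cong) auto
    moreover have "(\<lambda>x. x k) \<circ> (\<lambda>\<omega>. restrict (\<lambda>i. X i \<omega>) {k}) = X k"
      by auto
    ultimately have ind: "indep_var borel (\<lambda>\<omega>. U k (\<lambda>i. X i \<omega>)) borel (X k)" by simp
    have "integrable M (\<lambda>\<omega>. U k (\<lambda>i. X i \<omega>))"
      using indep_var_rv1[OF ind] U_bound by (intro integrable_const_bound[of _ a]) auto
    then show ?thesis
      using indep_var_integrable[OF ind _ int[OF k]] indep_var_lebesgue_integral[OF ind _ int[OF k]] mean[OF k]
      by simp
  qed
  have step: "integrable M (\<lambda>\<omega>. (T k \<omega>)\<^sup>2) \<and>
      expectation (\<lambda>\<omega>. (T k \<omega>)\<^sup>2) \<le> (\<Sum>i<k. expectation (\<lambda>\<omega>. (X i \<omega>)\<^sup>2))" if "k \<le> n" for k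
    using that
  proof (induction k)
    case 0
    then show ?case by (simp add: T_def)
  next
    case (Suc k)
    then have k: "k < n" by simp
    note [measurable] = B_meas[OF less_imp_le[OF k]] meas[OF k]
    have BX: "integrable M (\<lambda>\<omega>. B k \<omega> * (X k \<omega>)\<^sup>2)"
      by (rule Bochner_Integration.integrable_bound[OF sq[OF k]]) (measurable, simp add: B_def)
    \<comment> \<open>The indicator is at most 1, so each step raises the second moment of the
      stopped sum by at most that of \<open>X k\<close>.\<close>
    have "expectation (\<lambda>\<omega>. B k \<omega> * (X k \<omega>)\<^sup>2) \<le> expectation (\<lambda>\<omega>. (X k \<omega>)\<^sup>2)"
      by (intro integral_mono BX sq k) (auto simp: B_def)
    then show ?case
      using Suc cross[OF k] BX by (simp add: T_Suc)
  qed
  have "{\<omega> \<in> space M. \<exists>k\<le>n. a \<le> \<bar>\<Sum>i<k. X i \<omega>\<bar>} \<subseteq> {\<omega> \<in> space M. a\<^sup>2 \<le> (T n \<omega>)\<^sup>2}"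
  proof (intro Collect_mono impI conjI; elim conjE)
    fix \<omega> assume "\<exists>k\<le>n. a \<le> \<bar>\<Sum>i<k. X i \<omega>\<bar>"
    then have "\<not> below_level a (\<lambda>i. X i \<omega>) n" by (auto simp: below_level_def not_less)
    from stopped_sum_ge[OF a this] show "a\<^sup>2 \<le> (T n \<omega>)\<^sup>2"
      using a by (simp add: T_def abs_le_square_iff[symmetric])
  qed auto
  moreover have "{\<omega> \<in> space M. a\<^sup>2 \<le> (T n \<omega>)\<^sup>2} \<in> events"
    using borel_measurable_integrable[OF conjunct1[OF step[of n]]] by auto
  ultimately have "prob {\<omega> \<in> space M. \<exists>k\<le>n. a \<le> \<bar>\<Sum>i<k. X i \<omega>\<bar>} \<le> prob {\<omega> \<in> space M. a\<^sup>2 \<le> (T n \<omega>)\<^sup>2}"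
    by (intro finite_measure_mono)
  also have "\<dots> \<le> expectation (\<lambda>\<omega>. (T n \<omega>)\<^sup>2) / a\<^sup>2"
    using step[of n] a by (intro integral_Markov_inequality_measure[where A="{}"]) auto
  also have "\<dots> \<le> (\<Sum>i<n. expectation (\<lambda>\<omega>. (X i \<omega>)\<^sup>2)) / a\<^sup>2"
    using step[of n] by (intro divide_right_mono) auto
  finally show ?thesis .
qed

section \<open>Moments of the centered square of a standard normal variable\<close>

text \<open>The second and fourth moments are 1 and 3, so the variance of the square is 3 - 2 + 1 =
  2.\<close>

lemma std_normal_centered_square:
  assumes D: "distributed M lborel X std_normal_density"
  shows "integrable M (\<lambda>\<omega>. ((X \<omega>)\<^sup>2 - 1)\<^sup>2)"
    and "expectation (\<lambda>\<omega>. (X \<omega>)\<^sup>2 - 1) = 0"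
    and "expectation (\<lambda>\<omega>. ((X \<omega>)\<^sup>2 - 1)\<^sup>2) = 2"
proof -
  have int: "integrable M (\<lambda>\<omega>. (X \<omega>) ^ k)" for k
    using distributed_integrable[OF D, of "\<lambda>x. x ^ k"] integrable_std_normal_moment[of k] by simp
  have moment: "expectation (\<lambda>\<omega>. (X \<omega>) ^ (2 * k)) = fact (2 * k) / (2 ^ k * fact k)" for k
    using distributed_integral[OF D, of "\<lambda>x. x ^ (2 * k)"] integral_std_normal_moment_even[of k] by simp
  have m2: "expectation (\<lambda>\<omega>. (X \<omega>)\<^sup>2) = 1"
    using moment[of 1] by simp
  have m4: "expectation (\<lambda>\<omega>. (X \<omega>) ^ 4) = 3"
    using moment[of 2] by (simp add: fact_numeral)
  have eq: "((X \<omega>)\<^sup>2 - 1)\<^sup>2 = (X \<omega>) ^ 4 - 2 * (X \<omega>)\<^sup>2 + 1" for \<omega>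
    by (simp add: power2_eq_square power4_eq_xxxx algebra_simps)
  show "integrable M (\<lambda>\<omega>. ((X \<omega>)\<^sup>2 - 1)\<^sup>2)"
    unfolding eq using int by simp
  show "expectation (\<lambda>\<omega>. (X \<omega>)\<^sup>2 - 1) = 0"
    using int[of 2] m2 by (simp add: prob_space)
  show "expectation (\<lambda>\<omega>. ((X \<omega>)\<^sup>2 - 1)\<^sup>2) = 2"
    unfolding eq using int[of 2] int[of 4] m2 m4 by (simp add: prob_space)
qed

end

section \<open>Measurability and maximality of the arg max\<close>

(* The set of maximizers takes finitely many values, and each value is attained on an event. *)
lemma measurable_arg_max:
  fixes f :: "'i \<Rightarrow> 'a \<Rightarrow> real"
  assumes "finite A" and f: "\<And>k. k \<in> A \<Longrightarrow> f k \<in> borel_measurable M"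
  shows "(\<lambda>\<omega>. ARG_MAX (\<lambda>k. f k \<omega>) k. k \<in> A) \<in> measurable M (count_space UNIV)"
proof -
  \<comment> \<open>Equality of sets as a finite conjunction over \<open>A\<close> lets the event
    \<open>m \<omega> = S\<close> be assembled from finitely many comparisons.\<close>
  have Collect_eq: "{k \<in> A. P k} = S \<longleftrightarrow> (\<forall>k\<in>A. (k \<in> S) = P k)" if "S \<subseteq> A" for P S
    using that by blast
  define m where "m \<omega> = {k \<in> A. \<forall>y\<in>A. f y \<omega> \<le> f k \<omega>}" for \<omega>
  have "m \<in> measurable M (count_space (Pow A))"
  proof (subst measurable_count_space_eq2)
    show "finite (Pow A)" using \<open>finite A\<close> by simp
    have "m -` {S} \<inter> space M \<in> sets M" if "S \<in> Pow A" for S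
    proof -
      have pred: "Measurable.pred M (\<lambda>\<omega>. (k \<in> S) = (\<forall>y\<in>A. f y \<omega> \<le> f k \<omega>))" if "k \<in> A" for k
      proof -
        have "Measurable.pred M (\<lambda>\<omega>. \<forall>y\<in>A. f y \<omega> \<le> f k \<omega>)"
          using f that by (intro pred_intros_finite(3)[OF \<open>finite A\<close>]) (simp add: pred_def borel_measurable_le)
        then show ?thesis by (rule pred_intros_logic(6)[rotated]) simp
      qed
      have "Measurable.pred M (\<lambda>\<omega>. \<forall>k\<in>A. (k \<in> S) = (\<forall>y\<in>A. f y \<omega> \<le> f k \<omega>))"
        by (rule pred_intros_finite(3)[OF \<open>finite A\<close>]) (rule pred)
      moreover have "m \<omega> = S \<longleftrightarrow> (\<forall>k\<in>A. (k \<in> S) = (\<forall>y\<in>A. f y \<omega> \<le> f k \<omega>))" for \<omega>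
        unfolding m_def by (rule Collect_eq) (use that in simp)
      ultimately show ?thesis
        by (simp add: pred_def vimage_def Int_def conj_commute del: ball_simps)
    qed
    then show "m \<in> space M \<rightarrow> Pow A \<and> (\<forall>S\<in>Pow A. m -` {S} \<inter> space M \<in> sets M)"
      by (auto simp: m_def)
  qed
  \<comment> \<open>Every function on a discrete space is measurable, the choice operator included,
    so measurability of the set of maximizers is enough.\<close>
  then have "(\<lambda>\<omega>. SOME k. k \<in> m \<omega>) \<in> measurable M (count_space UNIV)"
    by (rule measurable_compose) simp
  then show ?thesis
    by (simp add: arg_max_def is_arg_max_linorder m_def Ball_def)
qed

text \<open>For \<open>2 \<le> n\<close> the index range is finite and nonempty, so a maximizer
  exists and the choice behind \<open>ARG_MAX\<close> really returns one.\<close>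

lemma change_estimator_arg_max:
  assumes "2 \<le> n"
  shows "change_estimator n z \<in> {1..n - 1}"
    and "k \<in> {1..n - 1} \<Longrightarrow> \<bar>cusum_stat n z k\<bar> \<le> \<bar>cusum_stat n z (change_estimator n z)\<bar>"
proof -
  define f where "f = (\<lambda>k. \<bar>cusum_stat n z k\<bar>)"
  have fin: "finite (f ` {1..n - 1})" "f ` {1..n - 1} \<noteq> {}" using assms by auto
  obtain m where m: "m \<in> {1..n - 1}" "f m = Max (f ` {1..n - 1})"
    using Max_in[OF fin] by auto
  then have "is_arg_max f (\<lambda>k. k \<in> {1..n - 1}) m"
    using fin by (auto simp: is_arg_max_linorder)
  then have "is_arg_max f (\<lambda>k. k \<in> {1..n - 1}) (change_estimator n z)"
    unfolding change_estimator_def arg_max_def f_def by (rule someI)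
  then show "change_estimator n z \<in> {1..n - 1}"
    and "k \<in> {1..n - 1} \<Longrightarrow> \<bar>cusum_stat n z k\<bar> \<le> \<bar>cusum_stat n z (change_estimator n z)\<bar>"
    by (auto simp: is_arg_max_linorder f_def)
qed

section \<open>Deterministic error bounds for a fixed sequence of observations\<close>

text \<open>This is the mean of S_k in the model: piecewise linear with a kink at the change
  point.\<close>

lemma sum_step_level:
  "(\<Sum>i=1..k. step_level \<theta>1 \<theta>2 k0 i) =
     (if k \<le> k0 then real k * \<theta>1 else real k0 * \<theta>1 + (real k - real k0) * \<theta>2)"
  by (induction k) (auto simp: step_level_def algebra_simps not_le le_Suc_eq le_less_Suc_eq)

text \<open>The tent falls from its peak with slope \<open>n - k0\<close> to the left and
  \<open>k0\<close> to the right, and \<open>c\<close> bounds both from below. The factor 4 comes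
  from noise of size at most \<open>2 * m * real n\<close> at each of the two indices
  compared.\<close>

lemma change_estimator_error:
  assumes k0: "1 \<le> k0" "k0 < n"
    and pos: "0 < sq_sum z n"
    and dev: "\<And>k. k \<le> n \<Longrightarrow> \<bar>sq_sum z k - (\<Sum>i=1..k. step_level \<theta>1 \<theta>2 k0 i)\<bar> \<le> m"
    and c: "c \<le> real k0" "c \<le> real (n - k0)"
  shows "c * \<bar>\<theta>2 - \<theta>1\<bar> * \<bar>real (change_estimator n z) - real k0\<bar> \<le> 4 * m * real n"
proof -
  define k where "k = change_estimator n z"
  define \<mu> where "\<mu> j = (\<Sum>i=1..j. step_level \<theta>1 \<theta>2 k0 i)" for j
  define e where "e j = sq_sum z j - \<mu> j" for j
  define g where "g j = (if j \<le> k0 then real j * real (n - k0) else real k0 * (real n - real j))" for j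
  have n: "2 \<le> n" "0 < real n" using k0 by auto
  have k: "1 \<le> k" "k < n"
    using change_estimator_arg_max(1)[OF n(1), of z] n(1) by (auto simp: k_def)
  \<comment> \<open>A constant level cancels in this combination; only the jump survives.\<close>
  have mu: "real j * \<mu> n - real n * \<mu> j = g j * (\<theta>2 - \<theta>1)" for j
    using k0 unfolding \<mu>_def sum_step_level by (simp add: g_def of_nat_diff algebra_simps)
  have noise: "\<bar>real j * e n - real n * e j\<bar> \<le> 2 * m * real n" if "j \<le> n" for j
  proof -
    have e: "\<bar>e n\<bar> \<le> m" "\<bar>e j\<bar> \<le> m"
      using dev[of n] dev[of j] that by (auto simp: e_def \<mu>_def)
    have "\<bar>real j * e n - real n * e j\<bar> \<le> \<bar>real j * e n\<bar> + \<bar>real n * e j\<bar>" by simp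
    also have "\<dots> \<le> real n * m + real n * m"
      unfolding abs_mult using e that by (intro add_mono mult_mono) auto
    finally show ?thesis by (simp add: algebra_simps)
  qed
  have cusum: "real n * sq_sum z n * cusum_stat n z j
      = g j * (\<theta>2 - \<theta>1) + (real j * e n - real n * e j)" for j
  proof -
    have "real n * sq_sum z n * cusum_stat n z j = real j * sq_sum z n - real n * sq_sum z j"
      using n pos by (simp add: cusum_stat_def field_simps)
    then show ?thesis using mu[of j] by (simp add: e_def algebra_simps)
  qed
  have g_nonneg: "0 \<le> g j" if "j \<le> n" for j using that by (simp add: g_def)
  have "\<bar>real n * sq_sum z n * cusum_stat n z k0\<bar> \<le> \<bar>real n * sq_sum z n * cusum_stat n z k\<bar>"
    using change_estimator_arg_max(2)[OF n(1), of k0 z] k0 n pos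
    by (simp add: abs_mult k_def mult_left_mono)
  \<comment> \<open>Removing the noise by the triangle inequality at \<open>k0\<close> and at
    \<open>k\<close> leaves a comparison of the two heights of the tent.\<close>
  then have "\<bar>g k0 * (\<theta>2 - \<theta>1)\<bar> - \<bar>g k * (\<theta>2 - \<theta>1)\<bar> \<le> 4 * m * real n"
    using noise[of k0] noise[of k] k k0 unfolding cusum by linarith
  then have main: "(g k0 - g k) * \<bar>\<theta>2 - \<theta>1\<bar> \<le> 4 * m * real n"
    using g_nonneg[of k0] g_nonneg[of k] k k0 by (simp add: abs_mult left_diff_distrib)
  have "c * \<bar>real k - real k0\<bar> \<le> g k0 - g k"
  proof (cases "k \<le> k0")
    case True
    then have "c * (real k0 - real k) \<le> real (n - k0) * (real k0 - real k)"
      using c by (intro mult_right_mono) auto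
    then show ?thesis using True by (simp add: g_def algebra_simps)
  next
    case False
    then have "c * (real k - real k0) \<le> real k0 * (real k - real k0)"
      using c by (intro mult_right_mono) auto
    then show ?thesis using False k0 by (simp add: g_def of_nat_diff algebra_simps)
  qed
  then have "c * \<bar>real k - real k0\<bar> * \<bar>\<theta>2 - \<theta>1\<bar> \<le> (g k0 - g k) * \<bar>\<theta>2 - \<theta>1\<bar>"
    by (intro mult_right_mono) auto
  with main show ?thesis by (simp add: k_def mult_ac)
qed

text \<open>Drift and diffusion coefficient cancel whatever value the scheme takes, since
  \<open>\<sigma>\<close> is positive on the whole line.\<close>

lemma standardized_increment_euler:
  assumes "\<And>x. 0 < \<sigma> x" and "0 < d"
  shows "standardized_increment b \<sigma> d (euler b \<sigma> \<theta> d x0 w) (Suc i) =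
    sqrt (\<theta> (Suc i)) * ((w (real (Suc i) * d) - w (real i * d)) / sqrt d)"
  using assms(2) assms(1)[of "euler b \<sigma> \<theta> d x0 w i", THEN less_imp_neq]
  by (simp add: standardized_increment_def)

text \<open>The condition \<open>2 \<le> real n * \<tau>\<close> absorbs the rounding, as n\<tau> -
  1 is then at least n\<tau>/2; hence the \<open>\<tau> / 2\<close> in \<open>c\<close>. The
  condition on \<open>A / (K * c)\<close> keeps the deviation below the mean of S_n, which makes S_n
  positive.\<close>

lemma change_fraction_error:
  fixes \<theta>1 \<theta>2 \<tau> A :: real and n :: nat
  defines "c \<equiv> min (\<tau> / 2) (1 - \<tau>)" and "K \<equiv> max \<theta>1 \<theta>2" and "k0 \<equiv> change_index \<tau> n"
  assumes \<tau>: "0 < \<tau>" "\<tau> < 1"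
    and \<theta>: "0 \<le> \<theta>1" "0 \<le> \<theta>2" "\<theta>1 \<noteq> \<theta>2"
    and n: "2 \<le> real n * \<tau>" "A / (K * c) < sqrt (real n)"
    and A: "0 \<le> A"
    and dev: "\<And>k. k \<le> n \<Longrightarrow>
      \<bar>sq_sum z k - (\<Sum>i=1..k. step_level \<theta>1 \<theta>2 k0 i)\<bar> \<le> A * sqrt (real n)"
  shows "sqrt (real n) * \<bar>\<theta>2 - \<theta>1\<bar> * \<bar>real (change_estimator n z) / real n - \<tau>\<bar>
    \<le> 4 * A / c + \<bar>\<theta>2 - \<theta>1\<bar>"
proof -
  have c: "0 < c" "c \<le> \<tau> / 2" "c \<le> 1 - \<tau>" using \<tau> by (auto simp: c_def min_def)
  have K: "0 < K" using \<theta> by (auto simp: K_def max_def)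
  have n_pos: "0 < real n" using n(1) \<tau> by (cases n) auto
  have k0_floor: "real k0 \<le> real n * \<tau>" "real n * \<tau> - 1 \<le> real k0"
    using n(1) by (auto simp: k0_def change_index_def)
  have lt: "real n * \<tau> < real n" using n_pos \<tau> by simp
  have k0: "1 \<le> k0" "k0 < n" using k0_floor n(1) lt by linarith+
  have ck0: "c * real n \<le> real k0"
  proof -
    have "c * real n \<le> \<tau> / 2 * real n" using c by (intro mult_right_mono) simp_all
    then show ?thesis using k0_floor n(1) by (simp add: mult.commute)
  qed
  have cnk0: "c * real n \<le> real (n - k0)"
  proof -
    have "c * real n \<le> (1 - \<tau>) * real n" using c by (intro mult_right_mono) simp_all
    then show ?thesis using k0_floor k0 by (simp add: of_nat_diff algebra_simps)
  qed
  have sq: "sqrt (real n) * sqrt (real n) = real n" using n_pos by simp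
  have pos: "0 < sq_sum z n"
  proof -
    have "A * sqrt (real n) < K * c * sqrt (real n) * sqrt (real n)"
      using n(2) K c n_pos by (intro mult_strict_right_mono) (auto simp: field_simps)
    also have "\<dots> = K * (c * real n)" using sq by (simp add: mult_ac)
    \<comment> \<open>One of the levels may be 0, so only the segment with the larger level
      \<open>K\<close> is counted; either segment has length at least
      \<open>c * real n\<close>.\<close>
    also have "\<dots> \<le> real k0 * \<theta>1 + real (n - k0) * \<theta>2"
    proof (cases "\<theta>1 \<le> \<theta>2")
      case True
      then have "K * (c * real n) \<le> \<theta>2 * real (n - k0)"
        using \<theta> cnk0 by (simp add: K_def max_def mult_left_mono)
      then show ?thesis using \<theta> by (simp add: mult_ac add_increasing)
    next
      case False
      then have "K * (c * real n) \<le> \<theta>1 * real k0"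
        using \<theta> ck0 by (simp add: K_def max_def mult_left_mono)
      then show ?thesis using \<theta> by (simp add: mult_ac add_increasing2)
    qed
    also have "\<dots> = (\<Sum>i=1..n. step_level \<theta>1 \<theta>2 k0 i)"
      unfolding sum_step_level using k0 by (simp add: of_nat_diff)
    finally show ?thesis using dev[of n] by linarith
  qed
  define D where "D = \<bar>real (change_estimator n z) - real k0\<bar>"
  have "c * real n * \<bar>\<theta>2 - \<theta>1\<bar> * D \<le> 4 * (A * sqrt (real n)) * real n"
    unfolding D_def by (rule change_estimator_error[OF k0 pos dev ck0 cnk0])
  then have "\<bar>\<theta>2 - \<theta>1\<bar> * D \<le> 4 * A / c * sqrt (real n)"
    using c n_pos by (simp add: field_simps)
  then have "sqrt (real n) * (\<bar>\<theta>2 - \<theta>1\<bar> * D) \<le> sqrt (real n) * (4 * A / c * sqrt (real n))"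
    by (intro mult_left_mono) auto
  also have "\<dots> = 4 * A / c * real n" by (subst sq[symmetric]) (simp only: mult_ac)
  finally have 1: "sqrt (real n) * \<bar>\<theta>2 - \<theta>1\<bar> * (D / real n) \<le> 4 * A / c"
    using n_pos by (simp add: divide_le_eq mult_ac)
  have "\<bar>real (change_estimator n z) / real n - \<tau>\<bar> = \<bar>real (change_estimator n z) - real n * \<tau>\<bar> / real n"
    using n_pos by (simp add: field_simps)
  \<comment> \<open>The extra 1 is the rounding error in replacing n\<tau> by \<open>k0\<close>.
    After scaling it contributes the summand \<open>\<bar>\<theta>2 - \<theta>1\<bar>\<close> of the
    final bound.\<close>
  also have "\<dots> \<le> (D + 1) / real n"
    unfolding D_def using k0_floor n_pos by (intro divide_right_mono) auto
  finally have "sqrt (real n) * \<bar>\<theta>2 - \<theta>1\<bar> * \<bar>real (change_estimator n z) / real n - \<tau>\<bar>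
      \<le> sqrt (real n) * \<bar>\<theta>2 - \<theta>1\<bar> * ((D + 1) / real n)"
    by (intro mult_left_mono) auto
  also have "\<dots> = sqrt (real n) * \<bar>\<theta>2 - \<theta>1\<bar> * (D / real n) + sqrt (real n) / real n * \<bar>\<theta>2 - \<theta>1\<bar>"
    by (simp add: add_divide_distrib algebra_simps)
  also have "\<dots> \<le> 4 * A / c + 1 * \<bar>\<theta>2 - \<theta>1\<bar>"
  proof (intro add_mono 1 mult_right_mono)
    have "1 \<le> real n" using k0 by linarith
    then have "1 \<le> sqrt (real n)" by simp
    then have "sqrt (real n) * 1 \<le> sqrt (real n) * sqrt (real n)" by (intro mult_left_mono) auto
    then show "sqrt (real n) / real n \<le> 1" using n_pos by simp
  qed auto
  finally show ?thesis by simp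
qed

text \<open>\<open>sq_sum\<close> starts at index 1; at index 0 the sequences may differ, since
  \<open>standardized_increment\<close> has no meaning there.\<close>

lemma change_estimator_cong:
  assumes "\<And>i. z (Suc i) = z' (Suc i)"
  shows "change_estimator n z = change_estimator n z'"
proof -
  have "sq_sum z = sq_sum z'"
    using assms by (auto simp: sq_sum_def sum.atLeast1_atMost_eq)
  then show ?thesis by (simp add: change_estimator_def cusum_stat_def)
qed

section \<open>Maximal inequality for weighted centered squares of Brownian increments\<close>

text \<open>The increments divided by \<open>sqrt d\<close> are independent standard normal
  variables, so each summand is centered with variance at most \<open>2 * K\<^sup>2\<close>.\<close>

lemma brownian_maximal_inequality:
  fixes M :: "'a measure"
  assumes W: "standard_brownian_motion M W" and d: "0 < d"
    and \<theta>: "\<And>i. i < n \<Longrightarrow> \<bar>\<theta> i\<bar> \<le> K" and a: "0 < a"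
  shows "measure M {\<omega> \<in> space M. \<exists>k\<le>n. a \<le>
      \<bar>\<Sum>i<k. \<theta> i * (((W (real (Suc i) * d) \<omega> - W (real i * d) \<omega>) / sqrt d)\<^sup>2 - 1)\<bar>}
    \<le> 2 * real n * K\<^sup>2 / a\<^sup>2"
proof -
  interpret prob_space M using W by (simp add: standard_brownian_motion_def)
  define \<xi> where "\<xi> i \<omega> = (W (real (Suc i) * d) \<omega> - W (real i * d) \<omega>) / sqrt d" for i \<omega>
  define Y where "Y i \<omega> = \<theta> i * ((\<xi> i \<omega>)\<^sup>2 - 1)" for i \<omega>
  have distr: "distributed M lborel (\<xi> i) std_normal_density" for i
  proof -
    have "distributed M lborel (\<lambda>\<omega>. W (real (Suc i) * d) \<omega> - W (real i * d) \<omega>)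
        (normal_density 0 (sqrt (real (Suc i) * d - real i * d)))"
      using W d by (simp add: standard_brownian_motion_def)
    moreover have "real (Suc i) * d - real i * d = d" by (simp add: algebra_simps)
    ultimately show ?thesis
      using normal_standard_normal_convert[of "sqrt d" _ 0] d by (simp add: \<xi>_def[abs_def])
  qed
  have "indep_vars (\<lambda>_. borel) (\<lambda>i \<omega>. W (real (Suc i) * d) \<omega> - W (real i * d) \<omega>) {..<n}"
  proof -
    have incr: "0 \<le> real 0 * d \<and> (\<forall>i<n. real i * d < real (Suc i) * d)" using d by simp
    have all: "\<forall>(m::nat) t. 0 \<le> t 0 \<and> (\<forall>i<m. t i < t (Suc i)) \<longrightarrow>
        indep_vars (\<lambda>_. borel) (\<lambda>i \<omega>. W (t (Suc i)) \<omega> - W (t i) \<omega>) {..<m}"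
      using W unfolding standard_brownian_motion_def by (elim conjE)
    show ?thesis
      using all[THEN spec[where x=n], THEN spec[where x="\<lambda>i. real i * d"], THEN mp, OF incr] .
  qed
  then have indep: "indep_vars (\<lambda>_. borel) Y {..<n}"
    unfolding Y_def[abs_def] \<xi>_def
    by (rule indep_vars_compose2[where Y="\<lambda>i x. \<theta> i * ((x / sqrt d)\<^sup>2 - 1)"]) simp
  have Y2: "(\<lambda>\<omega>. (Y i \<omega>)\<^sup>2) = (\<lambda>\<omega>. (\<theta> i)\<^sup>2 * ((\<xi> i \<omega>)\<^sup>2 - 1)\<^sup>2)" for i
    by (simp add: Y_def power_mult_distrib)
  have "prob {\<omega> \<in> space M. \<exists>k\<le>n. a \<le> \<bar>\<Sum>i<k. Y i \<omega>\<bar>} \<le> (\<Sum>i<n. expectation (\<lambda>\<omega>. (Y i \<omega>)\<^sup>2)) / a\<^sup>2"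
    using std_normal_centered_square[OF distr] a
    by (intro Kolmogorov_maximal_inequality indep) (simp_all add: Y2, simp add: Y_def)
  also have "\<dots> \<le> (\<Sum>i<n. 2 * K\<^sup>2) / a\<^sup>2"
  proof (intro divide_right_mono sum_mono)
    fix i assume "i \<in> {..<n}"
    then have "\<bar>\<theta> i\<bar>\<^sup>2 \<le> K\<^sup>2" using \<theta>[of i] by (intro power_mono) auto
    then show "expectation (\<lambda>\<omega>. (Y i \<omega>)\<^sup>2) \<le> 2 * K\<^sup>2"
      using std_normal_centered_square[OF distr] by (simp add: Y2)
  qed simp
  finally show ?thesis by (simp add: Y_def \<xi>_def mult_ac)
qed

section \<open>Rate of convergence of the change fraction estimator\<close>

theorem theorem3p1:
  fixes M :: "'a measure" and W :: "real \<Rightarrow> 'a \<Rightarrow> real"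
    and b \<sigma> :: "real \<Rightarrow> real" and l r :: ereal
    and \<Theta> :: "real set" and \<theta>1 \<theta>2 x0 T \<tau>0 :: real and \<Delta> :: "nat \<Rightarrow> real"
  assumes "standard_brownian_motion M W"
    and "x0 \<in> einterval l r"
    and "b C1_differentiable_on einterval l r"
    and "\<sigma> C1_differentiable_on einterval l r"
    and "\<And>x. 0 < \<sigma> x"
    and "\<And>x. x \<in> einterval l r \<Longrightarrow>
           filterlim (\<lambda>x1. LBINT u=x1..ereal x. scale_fun b \<sigma> x0 u) at_top (at_right l)"
    and "\<And>x. x \<in> einterval l r \<Longrightarrow>
           filterlim (\<lambda>x2. LBINT u=ereal x..x2. scale_fun b \<sigma> x0 u) at_top (at_left r)"
    and "compact \<Theta>" and "\<Theta> \<subseteq> {0..}"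
    and "\<theta>1 \<in> \<Theta>" and "\<theta>2 \<in> \<Theta>" and "\<theta>1 \<noteq> \<theta>2"
    and "0 < \<tau>0" and "\<tau>0 < 1"
    and "0 < T" and "\<And>n. 1 \<le> n \<Longrightarrow> real n * \<Delta> n = T" and "\<Delta> \<longlonglongrightarrow> 0"
  shows "\<exists>R. bigO_p M R (\<lambda>n. sqrt (ln (real n))) \<and>
    (\<forall>n\<ge>2. \<forall>\<omega>\<in>space M.
       \<bar>change_fraction_estimator b \<sigma> (\<Delta> n) n
          (euler b \<sigma> (step_level \<theta>1 \<theta>2 (change_index \<tau>0 n)) (\<Delta> n) x0 (\<lambda>t. W t \<omega>)) - \<tau>0\<bar>
       = real n powr (- 1 / 2) * inverse (\<theta>2 - \<theta>1) * R n \<omega>)"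
proof -
  interpret prob_space M using assms(1) by (simp add: standard_brownian_motion_def)
  define k0 where "k0 = change_index \<tau>0"
  define \<theta> where "\<theta> n = step_level \<theta>1 \<theta>2 (k0 n)" for n
  define \<xi> where "\<xi> n i \<omega> = (W (real (Suc i) * \<Delta> n) \<omega> - W (real i * \<Delta> n) \<omega>) / sqrt (\<Delta> n)" for n i \<omega>
  \<comment> \<open>\<open>\<xi>\<close> counts steps from 0 and \<open>Z\<close> from 1, hence the
    shift.\<close>
  define Z where "Z n \<omega> i = sqrt (\<theta> n i) * \<xi> n (i - 1) \<omega>" for n \<omega> i
  \<comment> \<open>\<open>R\<close> solves the claimed identity, so it carries the sign of
    \<open>\<theta>2 - \<theta>1\<close>. The value 0 for n < 2 keeps it measurable there too, as
    \<open>bigO_p\<close> demands for every index.\<close>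
  define R where "R n \<omega> = (if 2 \<le> n then sqrt (real n) * (\<theta>2 - \<theta>1) *
      \<bar>real (change_estimator n (Z n \<omega>)) / real n - \<tau>0\<bar> else 0)" for n \<omega>
  define K where "K = max \<theta>1 \<theta>2"
  define c where "c = min (\<tau>0 / 2) (1 - \<tau>0)"
  have \<theta>s: "0 \<le> \<theta>1" "0 \<le> \<theta>2" using assms(9-11) by auto
  have K: "0 < K" using \<theta>s assms(12) by (auto simp: K_def max_def)
  have level: "0 \<le> \<theta> n i" "\<bar>\<theta> n i\<bar> \<le> K" for n i
    using \<theta>s by (auto simp: \<theta>_def step_level_def K_def)
  have d: "0 < \<Delta> n" if "1 \<le> n" for n
  proof -
    have "0 < real n * \<Delta> n" using assms(15) assms(16)[OF that] by simp
    then show ?thesis using that by (simp add: zero_less_mult_iff)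
  qed
  have est: "change_fraction_estimator b \<sigma> (\<Delta> n) n (euler b \<sigma> (\<theta> n) (\<Delta> n) x0 (\<lambda>t. W t \<omega>))
      = real (change_estimator n (Z n \<omega>)) / real n" if "1 \<le> n" for n \<omega>
  proof -
    have "standardized_increment b \<sigma> (\<Delta> n) (euler b \<sigma> (\<theta> n) (\<Delta> n) x0 (\<lambda>t. W t \<omega>)) (Suc i) = Z n \<omega> (Suc i)" for i
      using standardized_increment_euler[OF assms(5) d[OF that]] by (simp add: Z_def \<xi>_def)
    then show ?thesis
      unfolding change_fraction_estimator_def by (subst change_estimator_cong[of _ "Z n \<omega>"]) auto
  qed
  have eq: "\<bar>change_fraction_estimator b \<sigma> (\<Delta> n) n
        (euler b \<sigma> (step_level \<theta>1 \<theta>2 (change_index \<tau>0 n)) (\<Delta> n) x0 (\<lambda>t. W t \<omega>)) - \<tau>0\<bar>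
      = real n powr (- 1 / 2) * inverse (\<theta>2 - \<theta>1) * R n \<omega>" if "2 \<le> n" for n \<omega>
  proof -
    have "real n powr (- 1 / 2) = inverse (sqrt (real n))"
      using that by (simp add: powr_half_sqrt powr_minus)
    moreover have "y = inverse (sqrt (real n)) * inverse (\<theta>2 - \<theta>1) * (sqrt (real n) * (\<theta>2 - \<theta>1) * y)" for y
      using that assms(12) by (simp add: field_simps)
    ultimately show ?thesis
      using that est[of n \<omega>] by (simp only: R_def \<theta>_def k0_def if_True)
  qed
  have W_meas: "W t \<in> borel_measurable M" if "0 \<le> t" for t
    using assms(1) that by (simp add: standard_brownian_motion_def)
  have R_meas: "R n \<in> borel_measurable M" for n
  proof (cases "2 \<le> n")
    case True
    have \<xi>_meas: "\<xi> n i \<in> borel_measurable M" for i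
      unfolding \<xi>_def[abs_def] using d[of n] True
      by (intro borel_measurable_divide borel_measurable_diff W_meas borel_measurable_const) auto
    have [measurable]: "(\<lambda>\<omega>. sq_sum (Z n \<omega>) k) \<in> borel_measurable M" for k
      unfolding sq_sum_def Z_def
      by (intro borel_measurable_sum borel_measurable_power borel_measurable_times \<xi>_meas borel_measurable_const)
    have "(\<lambda>\<omega>. change_estimator n (Z n \<omega>)) \<in> measurable M (count_space UNIV)"
      unfolding change_estimator_def by (rule measurable_arg_max) (auto simp: cusum_stat_def)
    then have [measurable]: "(\<lambda>\<omega>. real (change_estimator n (Z n \<omega>))) \<in> borel_measurable M"
      by (rule measurable_compose) simp
    show ?thesis using True unfolding R_def[abs_def] by simp
  qed (simp add: R_def[abs_def])
  have R_bound: "\<exists>C>0. \<forall>\<^sub>F n in sequentially.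
      prob {\<omega> \<in> space M. \<bar>R n \<omega>\<bar> > C * \<bar>sqrt (ln (real n))\<bar>} \<le> \<epsilon>" if "0 < \<epsilon>" for \<epsilon>
  proof -
    \<comment> \<open>Chosen so that the maximal inequality at level
      \<open>A * sqrt (real n)\<close> gives exactly \<open>\<epsilon>\<close>.\<close>
    define A where "A = K * sqrt (2 / \<epsilon>)"
    define C where "C = 4 * A / c + \<bar>\<theta>2 - \<theta>1\<bar>"
    have A: "0 < A" using K that by (simp add: A_def)
    have c: "0 < c" using assms(13,14) by (simp add: c_def)
    have C: "0 < C" using A c by (simp add: C_def add_pos_nonneg)
    have "\<forall>\<^sub>F n in sequentially. 2 / \<tau>0 \<le> real n"
      using filterlim_real_sequentially by (simp add: filterlim_at_top)
    moreover have "\<forall>\<^sub>F n in sequentially. A / (K * c) < sqrt (real n)"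
      using filterlim_compose[OF sqrt_at_top filterlim_real_sequentially]
      by (simp add: filterlim_at_top_dense)
    ultimately have "\<forall>\<^sub>F n in sequentially.
        prob {\<omega> \<in> space M. \<bar>R n \<omega>\<bar> > C * \<bar>sqrt (ln (real n))\<bar>} \<le> \<epsilon>"
      using eventually_ge_at_top[of 3]
    proof eventually_elim
      case (elim n)
      define Y where "Y i \<omega> = \<theta> n (Suc i) * ((\<xi> n i \<omega>)\<^sup>2 - 1)" for i \<omega>
      let ?bad = "{\<omega> \<in> space M. \<exists>k\<le>n. A * sqrt (real n) \<le> \<bar>\<Sum>i<k. Y i \<omega>\<bar>}"
      \<comment> \<open>The levels are nonnegative, so squaring undoes the root in \<open>Z\<close>;
        subtracting the mean then leaves the centered squares.\<close>
      have dev: "sq_sum (Z n \<omega>) k - (\<Sum>i=1..k. step_level \<theta>1 \<theta>2 (change_index \<tau>0 n) i) = (\<Sum>i<k. Y i \<omega>)" for k \<omega>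
        using level(1)[of n]
        by (simp add: sq_sum_def Z_def Y_def \<theta>_def k0_def sum.atLeast1_atMost_eq power_mult_distrib
            right_diff_distrib sum_subtractf)
      \<comment> \<open>From n = 3 on the logarithm is at least 1, so the bound \<open>C\<close>,
        which is free of logarithms, implies the stated one.\<close>
      have "exp 1 \<le> real n" using elim(3) exp_le by linarith
      then have "1 \<le> ln (real n)" using elim(3) by (subst ln_ge_iff) auto
      then have "1 \<le> sqrt (ln (real n))" by simp
      then have CC: "C \<le> C * \<bar>sqrt (ln (real n))\<bar>" using C by simp
      have good: "\<bar>R n \<omega>\<bar> \<le> C * \<bar>sqrt (ln (real n))\<bar>" if "\<omega> \<in> space M - ?bad" for \<omega>
      proof -
        have "\<bar>sq_sum (Z n \<omega>) k - (\<Sum>i=1..k. step_level \<theta>1 \<theta>2 (change_index \<tau>0 n) i)\<bar> \<le> A * sqrt (real n)"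
          if "k \<le> n" for k
          unfolding dev using that \<open>\<omega> \<in> space M - ?bad\<close> by (force simp: not_le)
        then have "sqrt (real n) * \<bar>\<theta>2 - \<theta>1\<bar> * \<bar>real (change_estimator n (Z n \<omega>)) / real n - \<tau>0\<bar> \<le> C"
          unfolding C_def c_def using elim A assms(12-14) \<theta>s
          by (intro change_fraction_error) (auto simp: c_def K_def field_simps)
        then show ?thesis using elim CC by (simp add: R_def abs_mult)
      qed
      have "Y i \<in> borel_measurable M" for i
        unfolding Y_def[abs_def] \<xi>_def[abs_def] using d[of n] elim(3)
        by (intro borel_measurable_times borel_measurable_const borel_measurable_diff borel_measurable_power
            borel_measurable_divide W_meas) auto
      then have bad_sets: "?bad \<in> events" by measurable
      have "prob {\<omega> \<in> space M. \<bar>R n \<omega>\<bar> > C * \<bar>sqrt (ln (real n))\<bar>} \<le> prob ?bad"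
        using good by (intro finite_measure_mono bad_sets) (force simp: not_le)
      also have "\<dots> \<le> 2 * real n * K\<^sup>2 / (A * sqrt (real n))\<^sup>2"
        unfolding Y_def \<xi>_def using elim(3) A d[of n] level
        by (intro brownian_maximal_inequality[OF assms(1)]) auto
      also have "\<dots> = \<epsilon>"
        using elim(3) K that \<open>0 < \<epsilon>\<close> by (simp add: A_def power_mult_distrib)
      finally show ?case .
    qed
    with C show ?thesis by blast
  qed
  have "bigO_p M R (\<lambda>n. sqrt (ln (real n)))"
    unfolding bigO_p_def using R_meas R_bound by blast
  with eq show ?thesis by blast
qed

end
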